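(* Let $\xi\in L^0(\mathbb R^d,\mathcal F_T)$. For any $0\le t\le T-1$ and any $V_{t-1}\in L^0(\mathbb R^d,\mathcal F_{t-1})$, almost surely $$\gamma_t^{\xi}(V_{t-1})=\operatorname*{ess\,inf}_{V_t\in L^0(\mathbb R^d,\mathcal F_t)}{}_{\mathcal F_t}\ \operatorname{ess\,sup}_{\mathcal F_t}\Big(C_t\big(0,V_t^{(2)}-V_{t-1}^{(2)}\big)+\gamma_{t+1}^{\xi}(V_t)\Big),$$ where the essential infimum is the $\mathcal F_t$-measurable conditional essential infimum over all $V_t\in L^0(\mathbb R^d,\mathcal F_t)$.
   Context: Setting. $(\Omega,(\mathcal F_t)_{t=0}^T,P)$ is a discrete-time stochastic basis with complete filtration ($\mathcal F_0$ contains the $P$-null sets); $\mathcal F_{-1}:=\mathcal F_0$. For a (random) set $A\subseteq\mathbb R^k$, $L^0(A,\mathcal F_t)$ is the set of (classes of) $\mathcal F_t$-measurable random variables $X$ with $X\in A$ a.s. For $z\in\mathbb R^d$ write $z=(z^1,z^{(2)})$ with $z^{(2)}=(z^2,\dots,z^d)$, and $e_1=(1,0,\dots,0)$. For a family of random variables, $\operatorname{ess\,sup}_{\mathcal F_t}$ (resp. $\operatorname{ess\,inf}_{\mathcal F_t}$) is the smallest (resp. largest) $\mathcal F_t$-measurable $[-\infty,\infty]$-valued random variable which a.s. dominates (resp. is a.s. dominated by) every member of the family; for a single random variable $X$ it is that of the family $\{X\}$. Market. $S_t$ is an $\mathcal F_t$-measurable $\mathbb R^m_+$-valued random variable ($m\ge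 d\ge 1$). For $t\le T$ the cost function $C_t:\mathbb R^m\times\mathbb R^d\to\mathbb R$ is Borel and lower semicontinuous and satisfies: $C_t(s,0)=0$ for $s\in\mathbb R^m_+$; $C_t(s,x+\lambda e_1)=C_t(s,x)+\lambda$ for $\lambda\in\mathbb R$ (cash invariance); $C_T(s,x_2)\ge C_T(s,x_1)$ whenever $x_2-x_1\in\mathbb R^d_+$; $|C_t(s,x)|\le h_t(s,x)$ for a deterministic continuous function $h_t$. One writes $C_t(x)=C_t(S_t,x)$. Hedging costs. For $\xi\in L^0(\mathbb R^d,\mathcal F_T)$, $0\le t\le T$ and $V_{t-1}\in L^0(\mathbb R^d,\mathcal F_t)$, $$\gamma_t^{\xi}(V_{t-1}):=\operatorname*{ess\,inf}_{V^{(2)}\in\Pi_t^T(V_{t-1},\xi)}{}_{\mathcal F_t}\ \operatorname{ess\,sup}_{\mathcal F_t}\Big(\xi^1+\sum_{s=t}^T C_s\big(0,V_s^{(2)}-V_{s-1}^{(2)}\big)\Big),$$ where $\Pi_t^T(V_{t-1},\xi)$ is the set of families $(V_s^{(2)})_{s=t-1}^T$ whose entry at $t-1$ is the given $V_{t-1}^{(2)}$, with $V_s^{(2)}\in L^0(\mathbb R^{d-1},\mathcal F_s)$ for $s=t,\dots,T-1$ and $V_T^{(2)}=\xi^{(2)}$. In particular $\gamma_T^\xi(V_{T-1})=\xi^1+C_T(0,\xi^{(2)}-V_{T-1}^{(2)})$. *)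

theory Defs
  imports "HOL-Probability.Probability"
begin

text \<open>
  Random variables are represented by functions rather than by classes modulo null sets, so a
  statement about classes becomes an almost-sure statement about representatives.
\<close>

definition L0 :: "'a measure \<Rightarrow> 'b::topological_space set \<Rightarrow> 'a measure \<Rightarrow> ('a \<Rightarrow> 'b) set" where
  "L0 M A G = {X \<in> borel_measurable G. AE \<omega> in M. X \<omega> \<in> A}"

definition is_cond_ess_sup ::
    "'a measure \<Rightarrow> 'a measure \<Rightarrow> ('a \<Rightarrow> ereal) set \<Rightarrow> ('a \<Rightarrow> ereal) \<Rightarrow> bool" where
  "is_cond_ess_sup M G \<X> Y \<longleftrightarrow>
     Y \<in> borel_measurable G \<and>
     (\<forall>X\<in>\<X>. AE \<omega> in M. X \<omega> \<le> Y \<omega>) \<and>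
     (\<forall>Z\<in>borel_measurable G.
        (\<forall>X\<in>\<X>. AE \<omega> in M. X \<omega> \<le> Z \<omega>) \<longrightarrow> (AE \<omega> in M. Y \<omega> \<le> Z \<omega>))"

definition is_cond_ess_inf ::
    "'a measure \<Rightarrow> 'a measure \<Rightarrow> ('a \<Rightarrow> ereal) set \<Rightarrow> ('a \<Rightarrow> ereal) \<Rightarrow> bool" where
  "is_cond_ess_inf M G \<X> Y \<longleftrightarrow>
     Y \<in> borel_measurable G \<and>
     (\<forall>X\<in>\<X>. AE \<omega> in M. Y \<omega> \<le> X \<omega>) \<and>
     (\<forall>Z\<in>borel_measurable G.
        (\<forall>X\<in>\<X>. AE \<omega> in M. Z \<omega> \<le> X \<omega>) \<longrightarrow> (AE \<omega> in M. Z \<omega> \<le> Y \<omega>))"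

text \<open>
  On a probability space a conditional essential supremum (infimum) exists and is unique up to
  null sets; the following functions select some version of it.
\<close>

definition cond_ess_sup :: "'a measure \<Rightarrow> 'a measure \<Rightarrow> ('a \<Rightarrow> ereal) set \<Rightarrow> 'a \<Rightarrow> ereal" where
  "cond_ess_sup M G \<X> = (SOME Y. is_cond_ess_sup M G \<X> Y)"

definition cond_ess_inf :: "'a measure \<Rightarrow> 'a measure \<Rightarrow> ('a \<Rightarrow> ereal) set \<Rightarrow> 'a \<Rightarrow> ereal" where
  "cond_ess_inf M G \<X> = (SOME Y. is_cond_ess_inf M G \<X> Y)"

definition lower_semicontinuous :: "('b::topological_space \<Rightarrow> real) \<Rightarrow> bool" where
  "lower_semicontinuous f \<longleftrightarrow> (\<forall>z. ereal (f z) \<le> Liminf (at z) (\<lambda>y. ereal (f y)))"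

text \<open>
  The index type \<open>'d\<close> of \<open>real ^ 'd\<close> carries no order, so the position of the cash account (the
  first coordinate of the mathematical text) is a parameter \<open>i1 :: 'd\<close>, and \<open>e\<^sub>1\<close> is
  \<open>axis i1 1\<close>. The space of the remaining coordinates, of dimension \<open>CARD('d) - 1\<close> (possibly
  zero), is represented by the subspace \<open>{z. z $ i1 = 0}\<close>: the vector written
  \<open>(0, z\<^sup>(\<^sup>2\<^sup>))\<close> is \<open>risky i1 z\<close>, and it also stands for \<open>z\<^sup>(\<^sup>2\<^sup>)\<close> itself.
\<close>

definition risky :: "'d::finite \<Rightarrow> real ^ 'd \<Rightarrow> real ^ 'd" where
  "risky i1 z = (\<chi> i. if i = i1 then 0 else z $ i)"

definition risky_space :: "'d::finite \<Rightarrow> (real ^ 'd) set" where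
  "risky_space i1 = {z. z $ i1 = 0}"

text \<open>
  Only the values of \<open>F\<close> (and of \<open>S\<close>, \<open>C\<close> below) at times up to \<open>T\<close> matter.
\<close>

locale stochastic_basis = prob_space M for M :: "'a measure" +
  fixes F :: "nat \<Rightarrow> 'a measure" and T :: nat
  assumes subalgebra_F: "\<And>t. t \<le> T \<Longrightarrow> subalgebra M (F t)"
    and mono_F: "\<And>s t. s \<le> t \<Longrightarrow> t \<le> T \<Longrightarrow> sets (F s) \<subseteq> sets (F t)"
    and complete_F: "null_sets M \<subseteq> sets (F 0)"

text \<open>The \<open>\<sigma>\<close>-algebra at time \<open>t - 1\<close>, with the convention that time \<open>-1\<close> is time \<open>0\<close>.\<close>

definition F_before :: "(nat \<Rightarrow> 'a measure) \<Rightarrow> nat \<Rightarrow> 'a measure" where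
  "F_before F t = (if t = 0 then F 0 else F (t - 1))"

locale market = stochastic_basis M F T
  for M :: "'a measure" and F :: "nat \<Rightarrow> 'a measure" and T :: nat +
  fixes S :: "nat \<Rightarrow> 'a \<Rightarrow> real ^ 'm::finite"
    and C :: "nat \<Rightarrow> real ^ 'm \<Rightarrow> real ^ 'd::finite \<Rightarrow> real"
    and i1 :: 'd
  assumes dims: "CARD('d) \<le> CARD('m)"
    and S_L0: "\<And>t. t \<le> T \<Longrightarrow> S t \<in> L0 M {s. 0 \<le> s} (F t)"
    and C_borel: "\<And>t. t \<le> T \<Longrightarrow> (\<lambda>(s, x). C t s x) \<in> borel_measurable borel"
    and C_lsc: "\<And>t. t \<le> T \<Longrightarrow> lower_semicontinuous (\<lambda>(s, x). C t s x)"
    and C_zero: "\<And>t s. t \<le> T \<Longrightarrow> 0 \<le> s \<Longrightarrow> C t s 0 = 0"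
    and C_cash: "\<And>t s x r. t \<le> T \<Longrightarrow> C t s (x + r *\<^sub>R axis i1 1) = C t s x + r"
    and C_T_mono: "\<And>s x1 x2. 0 \<le> x2 - x1 \<Longrightarrow> C T s x1 \<le> C T s x2"
    and C_bound: "\<And>t. t \<le> T \<Longrightarrow>
          \<exists>h. continuous_on UNIV h \<and> (\<forall>s x. \<bar>C t s x\<bar> \<le> h (s, x))"

text \<open>
  Strategies are stored with the index shifted by one, in order to accommodate the entry at
  time \<open>t - 1\<close> also for \<open>t = 0\<close>: \<open>U s\<close> is \<open>V\<^sub>s\<^sub>-\<^sub>1\<^sup>(\<^sup>2\<^sup>)\<close>, for \<open>s = t, \<dots>, T + 1\<close>.
  The argument \<open>V\<close> is the given \<open>V\<^sub>t\<^sub>-\<^sub>1\<close>.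
\<close>

definition strategies ::
    "'a measure \<Rightarrow> (nat \<Rightarrow> 'a measure) \<Rightarrow> nat \<Rightarrow> 'd::finite \<Rightarrow> ('a \<Rightarrow> real ^ 'd) \<Rightarrow>
     nat \<Rightarrow> ('a \<Rightarrow> real ^ 'd) \<Rightarrow> (nat \<Rightarrow> 'a \<Rightarrow> real ^ 'd) set" where
  "strategies M F T i1 \<xi> t V =
     {U. U t = (\<lambda>\<omega>. risky i1 (V \<omega>)) \<and>
         (\<forall>s\<in>{t..<T}. U (Suc s) \<in> L0 M (risky_space i1) (F s)) \<and>
         U (Suc T) = (\<lambda>\<omega>. risky i1 (\<xi> \<omega>))}"

definition hedging_cost ::
    "'a measure \<Rightarrow> (nat \<Rightarrow> 'a measure) \<Rightarrow> nat \<Rightarrow> (nat \<Rightarrow> 'a \<Rightarrow> real ^ 'm::finite) \<Rightarrow>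
     (nat \<Rightarrow> real ^ 'm \<Rightarrow> real ^ 'd::finite \<Rightarrow> real) \<Rightarrow> 'd \<Rightarrow> ('a \<Rightarrow> real ^ 'd) \<Rightarrow>
     nat \<Rightarrow> ('a \<Rightarrow> real ^ 'd) \<Rightarrow> 'a \<Rightarrow> ereal" where
  "hedging_cost M F T S C i1 \<xi> t V =
     cond_ess_inf M (F t)
       {cond_ess_sup M (F t)
          {\<lambda>\<omega>. ereal (\<xi> \<omega> $ i1 + (\<Sum>s=t..T. C s (S s \<omega>) (U (Suc s) \<omega> - U s \<omega>)))}
        | U. U \<in> strategies M F T i1 \<xi> t V}"

end

theory Submission
  imports Defs
begin

text \<open>
  The identity is a dynamic programming principle. Put
  \<open>J\<^sub>t(U) = \<xi>\<^sup>1 + (\<Sum>s=t..T. C\<^sub>s(U\<^sub>s\<^sub>+\<^sub>1 - U\<^sub>s))\<close>, so that \<open>J\<^sub>t(U) = c + J\<^sub>t\<^sub>+\<^sub>1(U)\<close>, where the first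
  cost \<open>c\<close> is real-valued and measurable at time \<open>t\<close>. Each side is the largest
  \<open>F t\<close>-measurable lower bound of its family, so it suffices that the left side is a lower
  bound of the family on the right and conversely.

  One direction only restricts a strategy to the times from \<open>t + 1\<close> on: if \<open>Y\<close> dominates
  \<open>J\<^sub>t(U)\<close> and is \<open>F t\<close>-measurable, then \<open>Y - c\<close> dominates \<open>J\<^sub>t\<^sub>+\<^sub>1(U)\<close> and is
  \<open>F (t + 1)\<close>-measurable, hence it dominates the hedging cost at \<open>t + 1\<close>
  (\<open>first_cost_plus_hedging_cost_le\<close>).

  For the other direction, fix the position \<open>Vt\<close> and let \<open>Y\<close> be the essential supremum of
  \<open>c + \<gamma>\<^sub>t\<^sub>+\<^sub>1(Vt)\<close>. An essential infimum over measurable functions is almost surely the infimum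
  of a sequence (\<open>countable_AE_minorant\<close>), so \<open>\<gamma>\<^sub>t\<^sub>+\<^sub>1(Vt)\<close> is the infimum of the superhedging
  prices of countably many strategies. For a rational \<open>q\<close>, on the event \<open>Y < q\<close> one of these
  has \<open>c\<close> plus its price below \<open>q\<close>; the first such index is known at time \<open>t + 1\<close>,
  so selecting it scenario by scenario again yields a strategy. Its \<open>J\<^sub>t\<close> is below \<open>q\<close>
  on \<open>Y < q\<close>, whence \<open>\<gamma>\<^sub>t \<le> q\<close> there (\<open>hedging_cost_le\<close>). Letting \<open>q\<close> run through the
  rationals gives \<open>\<gamma>\<^sub>t \<le> Y\<close>. Working with \<open>q\<close> instead of \<open>Y + \<epsilon>\<close> treats infinite values
  of \<open>Y\<close> and of the hedging costs uniformly.
\<close>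

section \<open>Conditional essential bounds\<close>

text \<open>
  A bounded, strictly increasing, measurable image of the extended reals makes infima of
  arbitrary extended-real functions comparable through their integrals.
\<close>

definition squash :: "ereal \<Rightarrow> real" where
  "squash x = (if x = \<infinity> then 2 else if x = -\<infinity> then -2 else arctan (real_of_ereal x))"

lemma measurable_squash [measurable]: "squash \<in> borel_measurable borel"
  unfolding squash_def by measurable

lemma abs_squash_le: "\<bar>squash x\<bar> \<le> 2"
proof -
  have "\<bar>arctan y\<bar> \<le> 2" for y
    using arctan_bounded[of y] pi_half_less_two by linarith
  then show ?thesis
    by (simp add: squash_def)
qed

lemma strict_mono_squash: "strict_mono squash"
proof (rule strict_monoI)
  fix x y :: ereal
  assume "x < y"
  moreover have "-2 < arctan z" "arctan z < 2" for z
    using arctan_bounded[of z] pi_half_less_two by linarith+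
  ultimately show "squash x < squash y"
    by (cases x; cases y) (auto simp: squash_def arctan_less_iff)
qed

text \<open>
  Among all countable subfamilies, one whose pointwise infimum has the smallest squashed
  integral exists, since countably many countable subfamilies can be merged. Adding one more
  member cannot decrease the integral any further, so it changes the infimum only on a null set.
\<close>

lemma (in finite_measure) countable_AE_minorant:
  fixes \<X> :: "('a \<Rightarrow> ereal) set"
  assumes "\<X> \<noteq> {}" and meas: "\<X> \<subseteq> borel_measurable M"
  obtains x :: "nat \<Rightarrow> 'a \<Rightarrow> ereal"
    where "range x \<subseteq> \<X>" and "\<And>X. X \<in> \<X> \<Longrightarrow> AE \<omega> in M. (INF k. x k \<omega>) \<le> X \<omega>"
proof -
  define low :: "(nat \<Rightarrow> 'a \<Rightarrow> ereal) \<Rightarrow> 'a \<Rightarrow> real"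
    where "low x \<omega> = squash (INF k. x k \<omega>)" for x \<omega>
  define seqs where "seqs = {x :: nat \<Rightarrow> 'a \<Rightarrow> ereal. range x \<subseteq> \<X>}"
  have low_integrable: "integrable M (low x)" if "x \<in> seqs" for x
  proof (rule integrable_const_bound[where B = 2])
    have [measurable]: "x k \<in> borel_measurable M" for k
      using that meas by (auto simp: seqs_def)
    show "low x \<in> borel_measurable M"
      unfolding low_def by measurable
  qed (simp add: low_def abs_squash_le)
  have low_mono: "low x \<omega> \<le> low y \<omega>" if "(INF k. x k \<omega>) \<le> (INF k. y k \<omega>)" for x y \<omega>
    using that strict_mono_squash by (simp add: low_def strict_mono_less_eq)
  define I where "I = (INF x\<in>seqs. integral\<^sup>L M (low x))"
  have bdd: "bdd_below ((\<lambda>x. integral\<^sup>L M (low x)) ` seqs)"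
  proof (rule bdd_belowI2)
    fix x assume "x \<in> seqs"
    have "integral\<^sup>L M (\<lambda>_. -2) \<le> integral\<^sup>L M (low x)"
    proof (rule integral_mono)
      show "integrable M (low x)" using low_integrable \<open>x \<in> seqs\<close> .
      show "-2 \<le> low x \<omega>" for \<omega>
        using abs_squash_le[of "INF k. x k \<omega>"] by (simp add: low_def)
    qed simp
    then show "-2 * measure M (space M) \<le> integral\<^sup>L M (low x)"
      by simp
  qed
  obtain X0 where "X0 \<in> \<X>"
    using assms(1) by blast
  then have "seqs \<noteq> {}"
    by (auto simp: seqs_def intro!: exI[of _ "\<lambda>_. X0"])
  have "\<exists>x\<in>seqs. integral\<^sup>L M (low x) < I + 1 / Suc n" for n
    using cINF_less_iff[OF \<open>seqs \<noteq> {}\<close> bdd, of "I + 1 / Suc n"] by (simp add: I_def)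
  then obtain x where x: "\<And>n. x n \<in> seqs" "\<And>n. integral\<^sup>L M (low (x n)) < I + 1 / Suc n"
    by metis
  define z where "z k = x (fst (prod_decode k)) (snd (prod_decode k))" for k
  have z: "z \<in> seqs"
    using x(1) by (auto simp: seqs_def z_def)
  have z_le: "(INF k. z k \<omega>) \<le> (INF k. x n k \<omega>)" for n \<omega>
  proof (rule INF_greatest)
    fix k
    show "(INF k. z k \<omega>) \<le> x n k \<omega>"
      by (rule INF_lower2[of "prod_encode (n, k)"]) (simp_all add: z_def)
  qed
  have z_min: "integral\<^sup>L M (low z) \<le> I"
  proof (rule field_le_epsilon)
    fix e :: real assume "0 < e"
    then obtain n where n: "1 / Suc n < e"
      using nat_approx_posE by metis
    have "integral\<^sup>L M (low z) \<le> integral\<^sup>L M (low (x n))"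
      by (intro integral_mono low_integrable z x low_mono z_le)
    with x(2)[of n] n show "integral\<^sup>L M (low z) \<le> I + e"
      by linarith
  qed
  show ?thesis
  proof (rule that[of z])
    show "range z \<subseteq> \<X>"
      using z by (simp add: seqs_def)
  next
    fix X assume X: "X \<in> \<X>"
    define w where "w = case_nat X z"
    have w: "w \<in> seqs"
      using z X by (auto simp: seqs_def w_def image_subset_iff split: nat.splits)
    have w_le_X: "(INF k. w k \<omega>) \<le> X \<omega>" for \<omega>
      by (rule INF_lower2[of 0]) (simp_all add: w_def)
    have w_le_z: "(INF k. w k \<omega>) \<le> (INF k. z k \<omega>)" for \<omega>
    proof (rule INF_greatest)
      fix k
      show "(INF k. w k \<omega>) \<le> z k \<omega>"
        by (rule INF_lower2[of "Suc k"]) (simp_all add: w_def)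
    qed
    have "I \<le> integral\<^sup>L M (low w)"
      unfolding I_def by (rule cINF_lower[OF bdd w])
    with z_min have "integral\<^sup>L M (\<lambda>\<omega>. low z \<omega> - low w \<omega>) \<le> 0"
      by (simp add: low_integrable z w)
    moreover have nonneg: "0 \<le> low z \<omega> - low w \<omega>" for \<omega>
      using low_mono[of w _ z, OF w_le_z] by simp
    ultimately have "integral\<^sup>L M (\<lambda>\<omega>. low z \<omega> - low w \<omega>) = 0"
      by (intro antisym integral_nonneg) auto
    then have "AE \<omega> in M. low z \<omega> - low w \<omega> = 0"
      using nonneg by (subst (asm) integral_nonneg_eq_0_iff_AE) (auto simp: low_integrable z w)
    then show "AE \<omega> in M. (INF k. z k \<omega>) \<le> X \<omega>"
    proof eventually_elim
      case (elim \<omega>)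
      then have "(INF k. z k \<omega>) = (INF k. w k \<omega>)"
        using strict_mono_squash by (simp add: low_def strict_mono_eq)
      with w_le_X[of \<omega>] show ?case
        by simp
    qed
  qed
qed

text \<open>
  The infimum of a countable family of measurable upper bounds is again one, so the smallest
  upper bound comes from applying the previous lemma to the upper bounds; this also covers
  families with non-measurable members.
\<close>

lemma (in finite_measure) is_cond_ess_sup_cond_ess_sup:
  assumes "subalgebra M G"
  shows "is_cond_ess_sup M G \<X> (cond_ess_sup M G \<X>)"
proof -
  define \<Z> where "\<Z> = {Z \<in> borel_measurable G. \<forall>X\<in>\<X>. AE \<omega> in M. X \<omega> \<le> Z \<omega>}"
  have "(\<lambda>_. \<infinity>) \<in> \<Z>"
    by (simp add: \<Z>_def)
  moreover have "\<Z> \<subseteq> borel_measurable M"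
    using measurable_from_subalg[OF assms] by (auto simp: \<Z>_def)
  ultimately obtain z :: "nat \<Rightarrow> 'a \<Rightarrow> ereal" where z: "range z \<subseteq> \<Z>"
    and least: "\<And>Z. Z \<in> \<Z> \<Longrightarrow> AE \<omega> in M. (INF k. z k \<omega>) \<le> Z \<omega>"
    using countable_AE_minorant[of \<Z>] by blast
  have [measurable]: "z k \<in> borel_measurable G" for k
    using z by (auto simp: \<Z>_def)
  have "is_cond_ess_sup M G \<X> (\<lambda>\<omega>. INF k. z k \<omega>)"
    unfolding is_cond_ess_sup_def
  proof (intro conjI ballI impI)
    show "(\<lambda>\<omega>. INF k. z k \<omega>) \<in> borel_measurable G"
      by measurable
  next
    fix X assume "X \<in> \<X>"
    then have "AE \<omega> in M. \<forall>k. X \<omega> \<le> z k \<omega>"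
      using z by (auto simp: AE_all_countable \<Z>_def)
    then show "AE \<omega> in M. X \<omega> \<le> (INF k. z k \<omega>)"
      by eventually_elim (auto intro: INF_greatest)
  next
    fix Z assume "Z \<in> borel_measurable G" "\<forall>X\<in>\<X>. AE \<omega> in M. X \<omega> \<le> Z \<omega>"
    then show "AE \<omega> in M. (INF k. z k \<omega>) \<le> Z \<omega>"
      by (intro least) (simp add: \<Z>_def)
  qed
  then show ?thesis
    unfolding cond_ess_sup_def by (rule someI[of "is_cond_ess_sup M G \<X>"])
qed

lemma is_cond_ess_inf_uminus:
  assumes "is_cond_ess_sup M G ((\<lambda>X \<omega>. - X \<omega>) ` \<X>) Y"
  shows "is_cond_ess_inf M G \<X> (\<lambda>\<omega>. - Y \<omega>)"
  unfolding is_cond_ess_inf_def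
proof (intro conjI ballI impI)
  show "(\<lambda>\<omega>. - Y \<omega>) \<in> borel_measurable G"
    using assms by (auto simp: is_cond_ess_sup_def)
next
  fix X assume "X \<in> \<X>"
  then have "AE \<omega> in M. - X \<omega> \<le> Y \<omega>"
    using assms by (simp add: is_cond_ess_sup_def)
  then show "AE \<omega> in M. - Y \<omega> \<le> X \<omega>"
    by eventually_elim (rule ereal_uminus_le_reorder[THEN iffD1])
next
  fix Z assume Z: "Z \<in> borel_measurable G" "\<forall>X\<in>\<X>. AE \<omega> in M. Z \<omega> \<le> X \<omega>"
  from Z(1) have "(\<lambda>\<omega>. - Z \<omega>) \<in> borel_measurable G"
    by measurable
  then have "AE \<omega> in M. Y \<omega> \<le> - Z \<omega>"
    using assms Z(2) by (auto simp: is_cond_ess_sup_def)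
  then show "AE \<omega> in M. Z \<omega> \<le> - Y \<omega>"
    by eventually_elim (metis ereal_minus_le_minus ereal_uminus_uminus)
qed

lemma (in finite_measure) is_cond_ess_inf_cond_ess_inf:
  assumes "subalgebra M G"
  shows "is_cond_ess_inf M G \<X> (cond_ess_inf M G \<X>)"
  unfolding cond_ess_inf_def
  by (rule someI[of "is_cond_ess_inf M G \<X>"], rule is_cond_ess_inf_uminus, rule is_cond_ess_sup_cond_ess_sup[OF assms])

context finite_measure
begin

context
  fixes G :: "'a measure"
  assumes sub: "subalgebra M G"
begin

lemma measurable_cond_ess_sup: "cond_ess_sup M G \<X> \<in> borel_measurable G"
  using is_cond_ess_sup_cond_ess_sup[OF sub] by (simp add: is_cond_ess_sup_def)

lemma AE_le_cond_ess_sup: "X \<in> \<X> \<Longrightarrow> AE \<omega> in M. X \<omega> \<le> cond_ess_sup M G \<X> \<omega>"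
  using is_cond_ess_sup_cond_ess_sup[OF sub] by (simp add: is_cond_ess_sup_def)

lemma cond_ess_sup_AE_le:
  assumes "Z \<in> borel_measurable G" "\<And>X. X \<in> \<X> \<Longrightarrow> AE \<omega> in M. X \<omega> \<le> Z \<omega>"
  shows "AE \<omega> in M. cond_ess_sup M G \<X> \<omega> \<le> Z \<omega>"
  using is_cond_ess_sup_cond_ess_sup[OF sub, of \<X>] assms by (simp add: is_cond_ess_sup_def)

lemma measurable_cond_ess_inf: "cond_ess_inf M G \<X> \<in> borel_measurable G"
  using is_cond_ess_inf_cond_ess_inf[OF sub] by (simp add: is_cond_ess_inf_def)

lemma cond_ess_inf_AE_le: "X \<in> \<X> \<Longrightarrow> AE \<omega> in M. cond_ess_inf M G \<X> \<omega> \<le> X \<omega>"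
  using is_cond_ess_inf_cond_ess_inf[OF sub] by (simp add: is_cond_ess_inf_def)

lemma AE_le_cond_ess_inf:
  assumes "Z \<in> borel_measurable G" "\<And>X. X \<in> \<X> \<Longrightarrow> AE \<omega> in M. Z \<omega> \<le> X \<omega>"
  shows "AE \<omega> in M. Z \<omega> \<le> cond_ess_inf M G \<X> \<omega>"
  using is_cond_ess_inf_cond_ess_inf[OF sub, of \<X>] assms by (simp add: is_cond_ess_inf_def)

text \<open>
  For a family of \<open>G\<close>-measurable functions a countable subfamily already has an infimum
  below every member, and that infimum is a competitor for the essential infimum.
\<close>

lemma cond_ess_inf_countable:
  assumes "\<X> \<noteq> {}" and "\<X> \<subseteq> borel_measurable G"
  obtains x :: "nat \<Rightarrow> 'a \<Rightarrow> ereal"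
    where "range x \<subseteq> \<X>" and "AE \<omega> in M. (INF k. x k \<omega>) \<le> cond_ess_inf M G \<X> \<omega>"
proof -
  have "\<X> \<subseteq> borel_measurable M"
    using assms(2) measurable_from_subalg[OF sub] by blast
  then obtain x :: "nat \<Rightarrow> 'a \<Rightarrow> ereal" where x: "range x \<subseteq> \<X>"
    "\<And>X. X \<in> \<X> \<Longrightarrow> AE \<omega> in M. (INF k. x k \<omega>) \<le> X \<omega>"
    using countable_AE_minorant[OF assms(1)] by metis
  have [measurable]: "x k \<in> borel_measurable G" for k
    using x(1) assms(2) by auto
  have "(\<lambda>\<omega>. INF k. x k \<omega>) \<in> borel_measurable G"
    by measurable
  then show ?thesis
    using that x AE_le_cond_ess_inf by blast
qed

end

end

section \<open>Strategies\<close>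

lemma measurable_risky [measurable]: "risky i1 \<in> borel_measurable borel"
proof (rule borel_measurable_continuous_onI)
  have "continuous_on UNIV (\<lambda>z. if i = i1 then 0 else z $ i)" for i
    by (cases "i = i1") (simp_all add: continuous_on_component)
  then show "continuous_on UNIV (risky i1)"
    unfolding risky_def by (rule continuous_on_vec_lambda)
qed

lemma risky_diff: "risky i1 (x - y) = risky i1 x - risky i1 y"
  by (simp add: risky_def vec_eq_iff)

lemma risky_in_risky_space: "risky i1 x \<in> risky_space i1"
  by (simp add: risky_def risky_space_def)

lemma risky_eq_self: "x \<in> risky_space i1 \<Longrightarrow> risky i1 x = x"
  by (auto simp: risky_def risky_space_def vec_eq_iff)

lemma (in stochastic_basis) subalgebra_F_mono:
  assumes "s \<le> t" "t \<le> T"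
  shows "subalgebra (F t) (F s)"
  using assms subalgebra_F[of s] subalgebra_F[of t] mono_F[of s t]
  by (auto simp: subalgebra_def)

context market
begin

definition total_cost :: "('a \<Rightarrow> real ^ 'd) \<Rightarrow> nat \<Rightarrow> (nat \<Rightarrow> 'a \<Rightarrow> real ^ 'd) \<Rightarrow> 'a \<Rightarrow> real" where
  "total_cost \<xi> t U \<omega> = \<xi> \<omega> $ i1 + (\<Sum>s=t..T. C s (S s \<omega>) (U (Suc s) \<omega> - U s \<omega>))"

definition superhedging_price ::
    "('a \<Rightarrow> real ^ 'd) \<Rightarrow> nat \<Rightarrow> (nat \<Rightarrow> 'a \<Rightarrow> real ^ 'd) \<Rightarrow> 'a \<Rightarrow> ereal" where
  "superhedging_price \<xi> t U = cond_ess_sup M (F t) {\<lambda>\<omega>. ereal (total_cost \<xi> t U \<omega>)}"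

definition first_cost :: "nat \<Rightarrow> ('a \<Rightarrow> real ^ 'd) \<Rightarrow> ('a \<Rightarrow> real ^ 'd) \<Rightarrow> 'a \<Rightarrow> real" where
  "first_cost t V Vt \<omega> = C t (S t \<omega>) (risky i1 (Vt \<omega> - V \<omega>))"

lemma hedging_cost_eq:
  "hedging_cost M F T S C i1 \<xi> t V =
     cond_ess_inf M (F t) (superhedging_price \<xi> t ` strategies M F T i1 \<xi> t V)"
  unfolding hedging_cost_def superhedging_price_def total_cost_def
  by (simp add: setcompr_eq_image)

lemma total_cost_Suc:
  "t \<le> T \<Longrightarrow> total_cost \<xi> t U \<omega> =
     C t (S t \<omega>) (U (Suc t) \<omega> - U t \<omega>) + total_cost \<xi> (Suc t) U \<omega>"
  by (simp add: total_cost_def sum.atLeast_Suc_atMost)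

lemma measurable_first_cost:
  assumes "t \<le> T" and [measurable]: "V \<in> borel_measurable (F t)" "Vt \<in> borel_measurable (F t)"
  shows "first_cost t V Vt \<in> borel_measurable (F t)"
proof -
  have [measurable]: "S t \<in> borel_measurable (F t)"
    using S_L0[OF assms(1)] by (simp add: L0_def)
  have C: "(\<lambda>(s, x). C t s x) \<in> borel_measurable (borel \<Otimes>\<^sub>M borel)"
    using C_borel[OF assms(1)] by (simp add: borel_prod)
  have "(\<lambda>\<omega>. (S t \<omega>, risky i1 (Vt \<omega> - V \<omega>))) \<in> F t \<rightarrow>\<^sub>M borel \<Otimes>\<^sub>M borel"
    by measurable
  from measurable_compose[OF this C] show ?thesis
    by (simp add: first_cost_def[abs_def])
qed

lemma AE_total_cost_le_superhedging_price:
  "t \<le> T \<Longrightarrow> AE \<omega> in M. ereal (total_cost \<xi> t U \<omega>) \<le> superhedging_price \<xi> t U \<omega>"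
  unfolding superhedging_price_def
  using AE_le_cond_ess_sup[OF subalgebra_F] by fastforce

lemma superhedging_price_AE_le:
  assumes "t \<le> T" "Z \<in> borel_measurable (F t)" "AE \<omega> in M. ereal (total_cost \<xi> t U \<omega>) \<le> Z \<omega>"
  shows "AE \<omega> in M. superhedging_price \<xi> t U \<omega> \<le> Z \<omega>"
  unfolding superhedging_price_def
  using assms by (intro cond_ess_sup_AE_le subalgebra_F) auto

lemma measurable_superhedging_price:
  "t \<le> T \<Longrightarrow> superhedging_price \<xi> t U \<in> borel_measurable (F t)"
  unfolding superhedging_price_def by (intro measurable_cond_ess_sup subalgebra_F)

lemma hedging_cost_AE_le_superhedging_price:
  assumes "t \<le> T" "U \<in> strategies M F T i1 \<xi> t V"
  shows "AE \<omega> in M. hedging_cost M F T S C i1 \<xi> t V \<omega> \<le> superhedging_price \<xi> t U \<omega>"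
  unfolding hedging_cost_eq using assms by (intro cond_ess_inf_AE_le subalgebra_F) auto

lemma strategies_nonempty:
  assumes "t \<le> T"
  shows "strategies M F T i1 \<xi> t V \<noteq> {}"
proof -
  have "(\<lambda>s \<omega>. if s = t then risky i1 (V \<omega>) else if s = Suc T then risky i1 (\<xi> \<omega>) else 0)
          \<in> strategies M F T i1 \<xi> t V"
    using assms by (auto simp: strategies_def L0_def risky_space_def)
  then show ?thesis
    by blast
qed

section \<open>The two inequalities\<close>

text \<open>
  A strategy from time \<open>t\<close> on is a strategy from time \<open>t + 1\<close> on with the given position
  \<open>U (Suc t)\<close>, up to changing that position on the null set where it has a cash component.
\<close>

lemma first_cost_plus_hedging_cost_le:
  assumes "t < T" and V: "V \<in> borel_measurable (F t)"
    and U: "U \<in> strategies M F T i1 \<xi> t V"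
  shows "AE \<omega> in M. ereal (first_cost t V (U (Suc t)) \<omega>)
             + hedging_cost M F T S C i1 \<xi> (Suc t) (U (Suc t)) \<omega>
           \<le> superhedging_price \<xi> t U \<omega>"
proof -
  define c where "c = first_cost t V (U (Suc t))"
  define Y where "Y = superhedging_price \<xi> t U"
  define U' where "U' = U(Suc t := (\<lambda>\<omega>. risky i1 (U (Suc t) \<omega>)))"
  have Ut: "U (Suc t) \<in> L0 M (risky_space i1) (F t)" "U t = (\<lambda>\<omega>. risky i1 (V \<omega>))"
    using U assms(1) by (auto simp: strategies_def)
  have U': "U' \<in> strategies M F T i1 \<xi> (Suc t) (U (Suc t))"
    using U assms(1) by (auto simp: strategies_def U'_def)
  have sub: "subalgebra (F (Suc t)) (F t)"
    using assms(1) by (intro subalgebra_F_mono) auto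
  have "c \<in> borel_measurable (F t)"
    unfolding c_def using assms(1) V Ut(1) by (intro measurable_first_cost) (auto simp: L0_def)
  then have [measurable]: "c \<in> borel_measurable (F (Suc t))"
    by (rule measurable_from_subalg[OF sub])
  have "Y \<in> borel_measurable (F t)"
    unfolding Y_def using assms(1) by (intro measurable_superhedging_price) simp
  then have [measurable]: "Y \<in> borel_measurable (F (Suc t))"
    by (rule measurable_from_subalg[OF sub])
  have "AE \<omega> in M. U (Suc t) \<omega> \<in> risky_space i1"
    using Ut(1) by (simp add: L0_def)
  moreover have "AE \<omega> in M. ereal (total_cost \<xi> t U \<omega>) \<le> Y \<omega>"
    unfolding Y_def using assms(1) by (intro AE_total_cost_le_superhedging_price) simp
  ultimately have "AE \<omega> in M. ereal (total_cost \<xi> (Suc t) U' \<omega>) \<le> Y \<omega> - ereal (c \<omega>)"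
  proof eventually_elim
    case (elim \<omega>)
    then have "U' s \<omega> = U s \<omega>" for s
      by (simp add: U'_def risky_eq_self)
    then have "total_cost \<xi> (Suc t) U' \<omega> = total_cost \<xi> (Suc t) U \<omega>"
      by (simp add: total_cost_def)
    moreover have "total_cost \<xi> t U \<omega> = c \<omega> + total_cost \<xi> (Suc t) U \<omega>"
      using assms(1) elim(1) Ut(2)
      by (simp add: total_cost_Suc c_def first_cost_def risky_diff risky_eq_self)
    ultimately show ?case
      using elim(2) by (cases "Y \<omega>") auto
  qed
  then have "AE \<omega> in M. superhedging_price \<xi> (Suc t) U' \<omega> \<le> Y \<omega> - ereal (c \<omega>)"
    using assms(1) by (intro superhedging_price_AE_le) auto
  moreover have "AE \<omega> in M. hedging_cost M F T S C i1 \<xi> (Suc t) (U (Suc t)) \<omega>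
      \<le> superhedging_price \<xi> (Suc t) U' \<omega>"
    using assms(1) U' by (intro hedging_cost_AE_le_superhedging_price) auto
  ultimately show ?thesis
    unfolding c_def[symmetric] Y_def[symmetric]
  proof eventually_elim
    case (elim \<omega>)
    from order_trans[OF elim(2,1)] show ?case
      by (cases "Y \<omega>"; cases "hedging_cost M F T S C i1 \<xi> (Suc t) (U (Suc t)) \<omega>") auto
  qed
qed

text \<open>
  The measurability required of a strategy survives switching between countably many
  strategies from time \<open>t + 1\<close> on, provided that the index is known at time \<open>t + 1\<close>:
  every choice made after time \<open>t\<close> may depend on it, and the position held after trading at
  time \<open>t\<close> is common to all of them.
\<close>

lemma pasted_strategy:
  assumes "t < T" and Vt: "Vt \<in> borel_measurable (F t)"
    and W: "\<And>k. W k \<in> strategies M F T i1 \<xi> (Suc t) Vt"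
    and N: "N \<in> F (Suc t) \<rightarrow>\<^sub>M count_space (UNIV :: nat set)"
  shows "(\<lambda>s \<omega>. if s \<le> t then risky i1 (V \<omega>) else W (N \<omega>) s \<omega>)
           \<in> strategies M F T i1 \<xi> t V"
proof -
  have W_Suc_t: "W k (Suc t) = (\<lambda>\<omega>. risky i1 (Vt \<omega>))" for k
    using W[of k] by (simp add: strategies_def)
  have W_end: "W k (Suc T) = (\<lambda>\<omega>. risky i1 (\<xi> \<omega>))" for k
    using W[of k] by (simp add: strategies_def)
  have "(\<lambda>\<omega>. W (N \<omega>) (Suc s) \<omega>) \<in> L0 M (risky_space i1) (F s)" if "t \<le> s" "s < T" for s
  proof (cases "s = t")
    case True
    have "(\<lambda>\<omega>. risky i1 (Vt \<omega>)) \<in> borel_measurable (F t)"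
      using Vt by measurable
    then show ?thesis
      using True by (simp add: W_Suc_t L0_def risky_in_risky_space)
  next
    case False
    then have mem: "W k (Suc s) \<in> L0 M (risky_space i1) (F s)" for k
      using W[of k] that by (auto simp: strategies_def)
    have N_s: "N \<in> F s \<rightarrow>\<^sub>M count_space UNIV"
      using False that by (intro measurable_from_subalg[OF subalgebra_F_mono N]) auto
    have "W k (Suc s) \<in> borel_measurable (F s)" for k
      using mem by (simp add: L0_def)
    then have "(\<lambda>\<omega>. W (N \<omega>) (Suc s) \<omega>) \<in> borel_measurable (F s)"
      by (rule measurable_compose_countable[where f = "\<lambda>k. W k (Suc s)", OF _ N_s])
    moreover have "AE \<omega> in M. \<forall>k. W k (Suc s) \<omega> \<in> risky_space i1"
      using mem by (simp add: L0_def AE_all_countable)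
    then have "AE \<omega> in M. W (N \<omega>) (Suc s) \<omega> \<in> risky_space i1"
      by eventually_elim simp
    ultimately show ?thesis
      by (simp add: L0_def)
  qed
  then show ?thesis
    using assms(1) by (simp add: strategies_def W_end)
qed

lemma hedging_cost_le:
  assumes "t < T" and V: "V \<in> borel_measurable (F t)" and Vt: "Vt \<in> borel_measurable (F t)"
    and Y: "Y \<in> borel_measurable (F t)"
    and Y_bound: "AE \<omega> in M. ereal (first_cost t V Vt \<omega>)
                    + hedging_cost M F T S C i1 \<xi> (Suc t) Vt \<omega> \<le> Y \<omega>"
  shows "AE \<omega> in M. hedging_cost M F T S C i1 \<xi> t V \<omega> \<le> Y \<omega>"
proof -
  define c where "c = first_cost t V Vt"
  have le: "t \<le> T" "Suc t \<le> T"
    using assms(1) by auto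
  have sub: "subalgebra (F (Suc t)) (F t)"
    using le by (intro subalgebra_F_mono) auto
  have [measurable]: "c \<in> borel_measurable (F (Suc t))"
    unfolding c_def by (intro measurable_from_subalg[OF sub] measurable_first_cost le V Vt)
  obtain x :: "nat \<Rightarrow> 'a \<Rightarrow> ereal"
    where x: "range x \<subseteq> superhedging_price \<xi> (Suc t) ` strategies M F T i1 \<xi> (Suc t) Vt"
    and x_inf: "AE \<omega> in M. (INF k. x k \<omega>) \<le> hedging_cost M F T S C i1 \<xi> (Suc t) Vt \<omega>"
    unfolding hedging_cost_eq
    by (rule cond_ess_inf_countable[OF subalgebra_F[OF le(2)],
          of "superhedging_price \<xi> (Suc t) ` strategies M F T i1 \<xi> (Suc t) Vt"])
       (use le(2) in \<open>auto simp: strategies_nonempty measurable_superhedging_price\<close>)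
  then have "\<forall>k. \<exists>U\<in>strategies M F T i1 \<xi> (Suc t) Vt. x k = superhedging_price \<xi> (Suc t) U"
    by blast
  then obtain W where W: "\<And>k. W k \<in> strategies M F T i1 \<xi> (Suc t) Vt"
    and xW: "\<And>k. x k = superhedging_price \<xi> (Suc t) (W k)"
    by metis
  have [measurable]: "x k \<in> borel_measurable (F (Suc t))" for k
    unfolding xW using le(2) by (rule measurable_superhedging_price)
  have W_cost: "AE \<omega> in M. \<forall>k. ereal (total_cost \<xi> (Suc t) (W k) \<omega>) \<le> x k \<omega>"
    unfolding AE_all_countable xW using AE_total_cost_le_superhedging_price[OF le(2)] by blast
  have below: "AE \<omega> in M. Y \<omega> < ereal q \<longrightarrow> hedging_cost M F T S C i1 \<xi> t V \<omega> \<le> ereal q"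
    for q :: real
  proof -
    define N where "N \<omega> = (LEAST k. ereal (c \<omega>) + x k \<omega> < ereal q)" for \<omega>
    have N: "N \<in> F (Suc t) \<rightarrow>\<^sub>M count_space UNIV"
      unfolding N_def by measurable
    define U where "U = (\<lambda>s \<omega>. if s \<le> t then risky i1 (V \<omega>) else W (N \<omega>) s \<omega>)"
    have U: "U \<in> strategies M F T i1 \<xi> t V"
      unfolding U_def by (rule pasted_strategy[OF assms(1) Vt W N])
    have U_cost: "total_cost \<xi> t U \<omega> = c \<omega> + total_cost \<xi> (Suc t) (W (N \<omega>)) \<omega>" for \<omega>
    proof -
      have "W k (Suc t) \<omega> = risky i1 (Vt \<omega>)" for k
        using W[of k] by (simp add: strategies_def)
      moreover have "total_cost \<xi> (Suc t) U \<omega> = total_cost \<xi> (Suc t) (W (N \<omega>)) \<omega>"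
        by (simp add: total_cost_def U_def)
      ultimately show ?thesis
        using le(1) by (simp add: total_cost_Suc c_def first_cost_def risky_diff U_def)
    qed
    (* Off the event "Y < q" nothing is claimed, so the bound to be dominated is infinite. *)
    define Z where "Z \<omega> = (if Y \<omega> < ereal q then ereal q else \<infinity>)" for \<omega>
    have [measurable]: "Z \<in> borel_measurable (F t)"
      unfolding Z_def using Y by measurable
    have "AE \<omega> in M. ereal (total_cost \<xi> t U \<omega>) \<le> Z \<omega>"
      using Y_bound x_inf W_cost
    proof eventually_elim
      case (elim \<omega>)
      show ?case
      proof (cases "Y \<omega> < ereal q")
        case True
        have "(INF k. x k \<omega>) < ereal (q - c \<omega>)"
          using True elim(1,2) unfolding c_def[symmetric]
          by (cases "hedging_cost M F T S C i1 \<xi> (Suc t) Vt \<omega>"; cases "Y \<omega>";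
              cases "INF k. x k \<omega>") auto
        then obtain k where "x k \<omega> < ereal (q - c \<omega>)"
          by (auto simp: INF_less_iff)
        then have "ereal (c \<omega>) + x k \<omega> < ereal q"
          by (cases "x k \<omega>") auto
        then have "ereal (c \<omega>) + x (N \<omega>) \<omega> < ereal q"
          unfolding N_def by (rule LeastI)
        moreover have "ereal (total_cost \<xi> t U \<omega>) \<le> ereal (c \<omega>) + x (N \<omega>) \<omega>"
          using elim(3)[rule_format, of "N \<omega>"] unfolding U_cost
          by (cases "x (N \<omega>) \<omega>") auto
        ultimately show ?thesis
          using True by (cases "x (N \<omega>) \<omega>") (auto simp: Z_def)
      qed (simp add: Z_def)
    qed
    then have "AE \<omega> in M. superhedging_price \<xi> t U \<omega> \<le> Z \<omega>"
      using le(1) by (intro superhedging_price_AE_le) auto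
    with hedging_cost_AE_le_superhedging_price[OF le(1) U] show ?thesis
      by eventually_elim (auto simp: Z_def)
  qed
  have "AE \<omega> in M. \<forall>r::rat. Y \<omega> < ereal (real_of_rat r)
          \<longrightarrow> hedging_cost M F T S C i1 \<xi> t V \<omega> \<le> ereal (real_of_rat r)"
    unfolding AE_all_countable using below by blast
  then show ?thesis
  proof eventually_elim
    case (elim \<omega>)
    show ?case
      by (rule ccontr) (use elim ereal_dense3 in \<open>fastforce simp: not_le\<close>)
  qed
qed

end

theorem theorem3p1:
  fixes M :: "'a measure" and F :: "nat \<Rightarrow> 'a measure" and T :: nat
    and S :: "nat \<Rightarrow> 'a \<Rightarrow> real ^ 'm::finite"
    and C :: "nat \<Rightarrow> real ^ 'm \<Rightarrow> real ^ 'd::finite \<Rightarrow> real"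
    and i1 :: 'd and \<xi> V :: "'a \<Rightarrow> real ^ 'd" and t :: nat
  assumes "market M F T S C i1"
    and "\<xi> \<in> L0 M UNIV (F T)"
    and "t < T"
    and "V \<in> L0 M UNIV (F_before F t)"
  shows "AE \<omega> in M. hedging_cost M F T S C i1 \<xi> t V \<omega> =
           cond_ess_inf M (F t)
             {cond_ess_sup M (F t)
                {\<lambda>\<omega>'. ereal (C t (S t \<omega>') (risky i1 (Vt \<omega>' - V \<omega>')))
                        + hedging_cost M F T S C i1 \<xi> (Suc t) Vt \<omega>'}
              | Vt. Vt \<in> L0 M UNIV (F t)} \<omega>"
proof -
  interpret market M F T S C i1
    by fact
  define g where "g Vt = cond_ess_sup M (F t)
      {\<lambda>\<omega>'. ereal (first_cost t V Vt \<omega>') + hedging_cost M F T S C i1 \<xi> (Suc t) Vt \<omega>'}" for Vt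
  have sub: "subalgebra M (F t)"
    using assms(3) by (intro subalgebra_F) simp
  have "subalgebra (F t) (F_before F t)"
    using assms(3) by (auto simp: F_before_def intro: subalgebra_F_mono)
  then have V: "V \<in> borel_measurable (F t)"
    using assms(4) measurable_from_subalg by (auto simp: L0_def)
  have "AE \<omega> in M. hedging_cost M F T S C i1 \<xi> t V \<omega>
      \<le> cond_ess_inf M (F t) (g ` L0 M UNIV (F t)) \<omega>"
  proof (rule AE_le_cond_ess_inf[OF sub])
    show "hedging_cost M F T S C i1 \<xi> t V \<in> borel_measurable (F t)"
      unfolding hedging_cost_eq by (rule measurable_cond_ess_inf[OF sub])
  next
    fix X assume "X \<in> g ` L0 M UNIV (F t)"
    then obtain Vt where X: "X = g Vt" and Vt: "Vt \<in> borel_measurable (F t)"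
      by (auto simp: L0_def)
    have "AE \<omega> in M. ereal (first_cost t V Vt \<omega>)
        + hedging_cost M F T S C i1 \<xi> (Suc t) Vt \<omega> \<le> g Vt \<omega>"
      unfolding g_def using AE_le_cond_ess_sup[OF sub] by fastforce
    moreover have "g Vt \<in> borel_measurable (F t)"
      unfolding g_def by (rule measurable_cond_ess_sup[OF sub])
    ultimately show "AE \<omega> in M. hedging_cost M F T S C i1 \<xi> t V \<omega> \<le> X \<omega>"
      unfolding X by (intro hedging_cost_le[OF assms(3) V Vt])
  qed
  moreover have "AE \<omega> in M. cond_ess_inf M (F t) (g ` L0 M UNIV (F t)) \<omega>
      \<le> hedging_cost M F T S C i1 \<xi> t V \<omega>"
    unfolding hedging_cost_eq[of \<xi> t V]
  proof (rule AE_le_cond_ess_inf[OF sub])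
    show "cond_ess_inf M (F t) (g ` L0 M UNIV (F t)) \<in> borel_measurable (F t)"
      by (rule measurable_cond_ess_inf[OF sub])
  next
    fix X assume "X \<in> superhedging_price \<xi> t ` strategies M F T i1 \<xi> t V"
    then obtain U where X: "X = superhedging_price \<xi> t U"
      and U: "U \<in> strategies M F T i1 \<xi> t V"
      by blast
    have "U (Suc t) \<in> L0 M UNIV (F t)"
      using U assms(3) by (auto simp: strategies_def L0_def)
    then have "AE \<omega> in M. cond_ess_inf M (F t) (g ` L0 M UNIV (F t)) \<omega> \<le> g (U (Suc t)) \<omega>"
      by (intro cond_ess_inf_AE_le[OF sub]) blast
    moreover have "AE \<omega> in M. g (U (Suc t)) \<omega> \<le> X \<omega>"
      unfolding g_def
    proof (rule cond_ess_sup_AE_le[OF sub])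
      show "X \<in> borel_measurable (F t)"
        unfolding X using assms(3) by (intro measurable_superhedging_price) simp
    qed (use first_cost_plus_hedging_cost_le[OF assms(3) V U] in \<open>auto simp: X\<close>)
    ultimately show "AE \<omega> in M. cond_ess_inf M (F t) (g ` L0 M UNIV (F t)) \<omega> \<le> X \<omega>"
      by eventually_elim simp
  qed
  ultimately have "AE \<omega> in M. hedging_cost M F T S C i1 \<xi> t V \<omega> =
      cond_ess_inf M (F t) (g ` L0 M UNIV (F t)) \<omega>"
    by eventually_elim simp
  then show ?thesis
    by (simp add: g_def first_cost_def setcompr_eq_image)
qed

end
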